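(* ${\rm cov}(\mathcal M)\le \mathfrak a(\mathcal{ND}_T)$ and $\mathfrak a\le\mathfrak a(\mathcal{ND}_T)$.
   Context: $T={}^{\omega>}2$ ordered by $b'\le_T b$ iff $b\subseteq b'$; for $f\in{}^\omega2$, $B(f)=\{f\restriction n:n\in\omega\}$; for $X\subseteq T$, $\lfloor X\rfloor=\{f\in{}^\omega2:|B(f)\cap X|=\aleph_0\}$. $\mathcal{ND}_T$ is the set of infinite $X\subseteq T$ with $\lfloor X\rfloor$ nowhere dense in ${}^\omega 2$. Two countable sets are almost disjoint (ad) if their intersection is finite; a family is ad if its distinct members are pairwise ad. For $\mathcal X\subseteq[S]^{\aleph_0}$ with $S=\bigcup\mathcal X$, a family $\mathcal F\subseteq\mathcal X$ is mad in $\mathcal X$ if it is ad and no $X\in\mathcal X$ is ad to every member of $\mathcal F$; $\mathfrak a(\mathcal X)=\min\{|\mathcal F|:|\mathcal F|\ge\aleph_0,\ \mathcal F\text{ mad in }\mathcal X\}$. $\mathfrak a$ is the almost disjointness number ($=\mathfrak a([\omega]^{\aleph_0})$), and ${\rm cov}(\mathcal M)$ is the covering number of the meager ideal. *)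

theory Defs
  imports "HOL-Analysis.Analysis"
begin

unbundle cardinal_syntax

text \<open>
  Cardinals are cardinal orders of the library, compared across types by \<open>\<le>o\<close>. The minimum
  \<open>min {|F| : F \<in> C}\<close> exists for every nonempty \<open>C\<close>, see \<open>min_card_attained\<close> and
  \<open>min_card_least\<close>; for empty \<open>C\<close> the term is unspecified. All classes \<open>C\<close> used below are
  shown to be nonempty.
\<close>

definition min_card :: "'a set set \<Rightarrow> 'a rel" where
  "min_card C = |SOME F. F \<in> C \<and> (\<forall>G\<in>C. |F| \<le>o |G| )|"

definition almost_disjoint :: "'a set \<Rightarrow> 'a set \<Rightarrow> bool" where
  "almost_disjoint A B \<longleftrightarrow> finite (A \<inter> B)"

definition ad_family :: "'a set set \<Rightarrow> bool" where
  "ad_family F \<longleftrightarrow> (\<forall>A\<in>F. \<forall>B\<in>F. A \<noteq> B \<longrightarrow> almost_disjoint A B)"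

definition mad_in :: "'a set set \<Rightarrow> 'a set set \<Rightarrow> bool" where
  "mad_in \<X> F \<longleftrightarrow> F \<subseteq> \<X> \<and> ad_family F \<and> \<not> (\<exists>X\<in>\<X>. \<forall>A\<in>F. almost_disjoint X A)"

definition ad_number_of :: "'a set set \<Rightarrow> 'a set rel" where
  "ad_number_of \<X> = min_card {F. infinite F \<and> mad_in \<X> F}"

definition ad_number :: "nat set rel" where
  "ad_number = ad_number_of {X. infinite X}"

definition nowhere_dense :: "'a::topological_space set \<Rightarrow> bool" where
  "nowhere_dense A \<longleftrightarrow> interior (closure A) = {}"

definition meager :: "'a::topological_space set \<Rightarrow> bool" where
  "meager A \<longleftrightarrow> (\<exists>N :: nat \<Rightarrow> 'a set. (\<forall>n. nowhere_dense (N n)) \<and> A = (\<Union>n. N n))"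

text \<open>
  The Cantor space is \<^typ>\<open>nat \<Rightarrow> bool\<close>, whose type class topology is the product of discrete
  spaces; the tree of finite binary sequences is \<^typ>\<open>bool list\<close>.
\<close>

definition cov_meager :: "(nat \<Rightarrow> bool) set rel" where
  "cov_meager = min_card {\<A>. (\<forall>A\<in>\<A>. meager A) \<and> \<Union>\<A> = UNIV}"

definition branch :: "(nat \<Rightarrow> bool) \<Rightarrow> bool list set" where
  "branch f = {map f [0..<n] | n. True}"

definition branches_of :: "bool list set \<Rightarrow> (nat \<Rightarrow> bool) set" where
  "branches_of X = {f. infinite (branch f \<inter> X)}"

definition ND\<^sub>T :: "bool list set set" where
  "ND\<^sub>T = {X. infinite X \<and> nowhere_dense (branches_of X)}"

lemma min_card_witness:
  assumes "C \<noteq> {}"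
  shows "\<exists>F. F \<in> C \<and> (\<forall>G\<in>C. |F| \<le>o |G| )"
proof -
  have "\<exists>r\<in>card_of ` C. \<forall>r'\<in>card_of ` C. r \<le>o r'"
    using assms by (intro exists_minim_Card_order) (auto simp: card_of_Card_order)
  then show ?thesis by blast
qed

lemma min_card_attained: "C \<noteq> {} \<Longrightarrow> \<exists>F\<in>C. min_card C = |F|"
  unfolding min_card_def using someI_ex[OF min_card_witness] by blast

lemma min_card_least: "G \<in> C \<Longrightarrow> min_card C \<le>o |G|"
  unfolding min_card_def using someI_ex[OF min_card_witness] by blast

lemma ad_family_extends_to_mad:
  assumes "F0 \<subseteq> \<X>" "ad_family F0" "\<And>X. X \<in> \<X> \<Longrightarrow> infinite X"
  shows "\<exists>F. F0 \<subseteq> F \<and> mad_in \<X> F"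
proof -
  define P where "P = {F. F0 \<subseteq> F \<and> F \<subseteq> \<X> \<and> ad_family F}"
  have "\<exists>M\<in>P. \<forall>F\<in>P. M \<subseteq> F \<longrightarrow> F = M"
  proof (rule subset_Zorn_nonempty)
    show "P \<noteq> {}" using assms unfolding P_def by auto
    fix C assume ne: "C \<noteq> {}" and C: "subset.chain P C"
    have CP: "C \<subseteq> P" and lin: "\<And>F G. F \<in> C \<Longrightarrow> G \<in> C \<Longrightarrow> F \<subseteq> G \<or> G \<subseteq> F"
      using C by (auto simp: subset_chain_def)
    have "ad_family (\<Union>C)"
      unfolding ad_family_def
    proof (intro ballI impI)
      fix A B assume "A \<in> \<Union>C" "B \<in> \<Union>C" "A \<noteq> B"
      then obtain F G where FG: "F \<in> C" "G \<in> C" "A \<in> F" "B \<in> G" by auto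
      then obtain H where "H \<in> C" "A \<in> H" "B \<in> H" using lin[of F G] by blast
      then show "almost_disjoint A B"
        using CP \<open>A \<noteq> B\<close> unfolding P_def ad_family_def by blast
    qed
    then show "\<Union>C \<in> P" using CP ne unfolding P_def by blast
  qed
  then obtain M where M: "M \<in> P" "\<And>F. F \<in> P \<Longrightarrow> M \<subseteq> F \<Longrightarrow> F = M" by blast
  have "\<not> (\<exists>X\<in>\<X>. \<forall>A\<in>M. almost_disjoint X A)"
  proof
    assume "\<exists>X\<in>\<X>. \<forall>A\<in>M. almost_disjoint X A"
    then obtain X where X: "X \<in> \<X>" "\<forall>A\<in>M. almost_disjoint X A" by blast
    then have "insert X M \<in> P"
      using M(1) unfolding P_def ad_family_def almost_disjoint_def by (auto simp: Int_commute)
    then have "X \<in> M" using M(2) by blast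
    then have "finite X" using X(2) unfolding almost_disjoint_def by force
    then show False using assms(3) X(1) by blast
  qed
  then have "mad_in \<X> M" using M(1) unfolding P_def mad_in_def by auto
  then show ?thesis using M(1) unfolding P_def by blast
qed

lemma infinite_mad_exists:
  assumes "F0 \<subseteq> \<X>" "ad_family F0" "infinite F0" "\<And>X. X \<in> \<X> \<Longrightarrow> infinite X"
  shows "{F. infinite F \<and> mad_in \<X> F} \<noteq> {}"
  using ad_family_extends_to_mad[OF assms(1,2,4)] assms(3) finite_subset by blast

lemma ad_number_class_nonempty:
  "{F. infinite F \<and> mad_in {X :: nat set. infinite X} F} \<noteq> {}"
proof -
  define col where "col k = range (\<lambda>n. prod_encode (k, n))" for k
  have inf: "infinite (col k)" for k
    unfolding col_def by (rule range_inj_infinite) (auto intro!: injI)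
  have dj: "k \<noteq> l \<Longrightarrow> col k \<inter> col l = {}" for k l
    unfolding col_def by auto
  have "inj col" using dj inf by (metis Int_absorb finite.emptyI injI)
  then have "infinite (range col)" by (rule range_inj_infinite)
  moreover have "ad_family (range col)"
    unfolding ad_family_def almost_disjoint_def using dj by (metis finite.emptyI imageE)
  ultimately show ?thesis
    using inf by (intro infinite_mad_exists[of "range col"]) auto
qed

lemma nowhere_dense_cantor_singleton: "nowhere_dense {f :: nat \<Rightarrow> bool}"
proof -
  have "\<not> open {f}"
  proof
    assume "open {f}"
    then have "openin (product_topology (\<lambda>i. euclidean) UNIV) {f}"
      by (simp add: open_fun_def)
    then obtain X where X: "f \<in> Pi\<^sub>E UNIV X" "finite {i. X i \<noteq> (UNIV :: bool set)}"
        "Pi\<^sub>E UNIV X \<subseteq> {f}"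
      using product_topology_open_contains_basis[of "\<lambda>i. euclidean" UNIV "{f}" f] by auto
    obtain n where n: "n \<notin> {i. X i \<noteq> UNIV}"
      using X(2) ex_new_if_finite infinite_UNIV_nat by blast
    have "f(n := \<not> f n) \<in> Pi\<^sub>E UNIV X" using X(1) n by (auto simp: PiE_def Pi_def)
    then show False using X(3) by (metis fun_upd_same singletonD subsetD)
  qed
  then have "interior {f} = {}"
    using interior_subset[of "{f}"] open_interior[of "{f}"] by (metis subset_singletonD)
  moreover have "closed {f}"
  proof -
    have "closed {g. g n = f n}" for n
      by (intro closed_Collect_eq continuous_on_product_coordinates continuous_on_const)
    then have "closed (\<Inter>n. {g. g n = f n})" by (intro closed_INT) auto
    moreover have "(\<Inter>n. {g. g n = f n}) = {f}" by auto
    ultimately show ?thesis by simp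
  qed
  ultimately show ?thesis by (simp add: nowhere_dense_def)
qed

lemma cov_meager_class_nonempty:
  "{\<A>. (\<forall>A\<in>\<A>. meager A) \<and> \<Union>\<A> = (UNIV :: (nat \<Rightarrow> bool) set)} \<noteq> {}"
proof -
  have "meager {f}" for f :: "nat \<Rightarrow> bool"
    unfolding meager_def using nowhere_dense_cantor_singleton[of f]
    by (intro exI[of _ "\<lambda>_. {f}"]) auto
  then have "range (\<lambda>f. {f}) \<in> {\<A>. (\<forall>A\<in>\<A>. meager A) \<and> \<Union>\<A> = (UNIV :: (nat \<Rightarrow> bool) set)}"
    by auto
  then show ?thesis by blast
qed

lemma branch_infinite: "infinite (branch f)"
proof -
  have "branch f = range (\<lambda>n. map f [0..<n])" unfolding branch_def by auto
  moreover have "inj (\<lambda>n. map f [0..<n])"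
    by (rule injI) (metis diff_zero length_map length_upt)
  ultimately show ?thesis by (simp add: range_inj_infinite)
qed

lemma branch_almost_disjoint:
  assumes "f \<noteq> g"
  shows "finite (branch f \<inter> branch g)"
proof -
  obtain k where k: "f k \<noteq> g k" using assms by blast
  have "branch f \<inter> branch g \<subseteq> (\<lambda>n. map f [0..<n]) ` {..k}"
  proof
    fix s assume "s \<in> branch f \<inter> branch g"
    then obtain n m where s: "s = map f [0..<n]" "s = map g [0..<m]"
      unfolding branch_def by blast
    then have "n = m" by (metis diff_zero length_map length_upt)
    then have "\<not> k < n" using s k by (auto simp: map_eq_conv)
    then show "s \<in> (\<lambda>n. map f [0..<n]) ` {..k}" using s by auto
  qed
  then show ?thesis by (rule finite_subset) auto
qed

lemma ND\<^sub>T_class_nonempty: "{F. infinite F \<and> mad_in ND\<^sub>T F} \<noteq> {}"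
proof -
  have "branches_of (branch f) = {f}" for f
    unfolding branches_of_def using branch_almost_disjoint branch_infinite by auto
  then have sub: "range branch \<subseteq> ND\<^sub>T"
    unfolding ND\<^sub>T_def using nowhere_dense_cantor_singleton branch_infinite by auto
  have "inj branch" by (metis Int_absorb branch_almost_disjoint branch_infinite injI)
  moreover have "infinite (UNIV :: (nat \<Rightarrow> bool) set)"
    by (simp add: finite_UNIV_fun)
  ultimately have "infinite (range branch)" using finite_imageD by blast
  moreover have "ad_family (range branch)"
    unfolding ad_family_def almost_disjoint_def using branch_almost_disjoint by (metis imageE)
  ultimately show ?thesis
    using sub by (intro infinite_mad_exists[of "range branch"]) (auto simp: ND\<^sub>T_def)
qed

end

theory Submission
  imports Defs
begin

text \<open>
  The branches \<open>\<lfloor>X\<rfloor>\<close> of the members \<open>X\<close> of a mad family in \<open>ND\<^sub>T\<close> cover the Cantor space, since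
  a branch \<open>f\<close> outside all of them would make \<open>B(f) \<in> ND\<^sub>T\<close> almost disjoint to the whole family;
  this bounds \<open>cov(\<M>)\<close>.

  For the bound on the almost disjointness number, note that every infinite subset of a set
  \<open>S \<in> ND\<^sub>T\<close> is again in \<open>ND\<^sub>T\<close>. Hence the infinite traces on \<open>S\<close> of a family mad in \<open>ND\<^sub>T\<close> form
  a mad family of subsets of the countable set \<open>S\<close>. It remains to choose \<open>S\<close> so that infinitely
  many traces are infinite. By Koenig's lemma there is \<open>f\<close> such that above each \<open>f\<restriction>k\<close>
  infinitely many members of the family are infinite. Let \<open>S\<close> collect, for each \<open>k\<close>, the part of
  such a member above \<open>f\<restriction>k\<close>, using infinitely many members altogether. Away from \<open>f\<close>, the
  branches of \<open>S\<close> are locally those of finitely many members, so \<open>\<lfloor>S\<rfloor>\<close> is nowhere dense.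
\<close>

section \<open>Nowhere dense sets in the Cantor space\<close>

lemma nowhere_dense_subset: "nowhere_dense B \<Longrightarrow> A \<subseteq> B \<Longrightarrow> nowhere_dense A"
  unfolding nowhere_dense_def by (metis closure_mono interior_mono subset_empty)

lemma nowhere_dense_Un: "nowhere_dense A \<Longrightarrow> nowhere_dense B \<Longrightarrow> nowhere_dense (A \<union> B)"
  unfolding nowhere_dense_def by (simp add: interior_closed_Un_empty_interior)

lemma nowhere_dense_UN:
  assumes "finite I" "\<And>i. i \<in> I \<Longrightarrow> nowhere_dense (A i)"
  shows "nowhere_dense (\<Union>i\<in>I. A i)"
  using assms
proof (induction I rule: finite_induct)
  case empty
  then show ?case by (simp add: nowhere_dense_def)
next
  case (insert i I)
  then show ?case by (simp add: nowhere_dense_Un)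
qed

text \<open>A nonempty open set inside the closure of \<open>A\<close> would contain some
  \<open>g\<close> other than \<open>f\<close>, as singletons have empty interior. If
  \<open>g\<close> and \<open>f\<close> differ at \<open>k\<close>, intersecting with the open set
  of all \<open>h\<close> differing from \<open>f\<close> at \<open>k\<close> contradicts the
  assumption for \<open>k\<close>.\<close>

lemma nowhere_dense_cantor_if_locally:
  fixes f :: "nat \<Rightarrow> bool"
  assumes "\<And>k. nowhere_dense ({h. h k \<noteq> f k} \<inter> A)"
  shows "nowhere_dense A"
proof (rule ccontr)
  define U where "U = interior (closure A)"
  assume "\<not> nowhere_dense A"
  then have "U \<noteq> {}" by (simp add: nowhere_dense_def U_def)
  have "open U" by (simp add: U_def)
  have "\<not> U \<subseteq> {f}"
  proof
    assume "U \<subseteq> {f}"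
    then have "U \<subseteq> interior (closure {f})"
      using \<open>open U\<close> closure_subset[of "{f}"] by (intro interior_maximal) auto
    then show False
      using nowhere_dense_cantor_singleton[of f] \<open>U \<noteq> {}\<close> by (simp add: nowhere_dense_def)
  qed
  then obtain g where g: "g \<in> U" "g \<noteq> f" by auto
  then obtain k where k: "g k \<noteq> f k" by blast
  define V where "V = {h. h k \<noteq> f k}"
  have "open V"
    unfolding V_def
    by (intro open_Collect_neq continuous_on_product_coordinates continuous_on_const)
  have "V \<inter> U \<subseteq> V \<inter> closure A" using interior_subset unfolding U_def by blast
  also have "\<dots> \<subseteq> closure (V \<inter> A)" using \<open>open V\<close> by (rule open_Int_closure_subset)
  finally have "V \<inter> U \<subseteq> interior (closure (V \<inter> A))"
    using \<open>open V\<close> \<open>open U\<close> by (intro interior_maximal) auto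
  moreover have "g \<in> V \<inter> U" using g k by (simp add: V_def)
  ultimately show False using assms[of k] by (auto simp: nowhere_dense_def V_def)
qed

section \<open>Branches through subsets of the tree\<close>

lemma branches_of_mono: "X \<subseteq> Y \<Longrightarrow> branches_of X \<subseteq> branches_of Y"
  unfolding branches_of_def by (blast intro: finite_subset[OF Int_mono[OF order_refl]])

lemma branches_of_UN:
  assumes "finite I"
  shows "branches_of (\<Union>i\<in>I. X i) = (\<Union>i\<in>I. branches_of (X i))"
proof -
  have "infinite (branch f \<inter> (\<Union>i\<in>I. X i)) \<longleftrightarrow> (\<exists>i\<in>I. infinite (branch f \<inter> X i))" for f
    unfolding Int_UN_distrib finite_UN[OF assms] by simp
  then show ?thesis by (simp add: branches_of_def set_eq_iff)
qed

lemma branch_in_ND\<^sub>T: "branch f \<in> ND\<^sub>T"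
proof -
  have "branches_of (branch f) = {f}"
    unfolding branches_of_def using branch_almost_disjoint branch_infinite by auto
  then show ?thesis
    using nowhere_dense_cantor_singleton branch_infinite by (simp add: ND\<^sub>T_def)
qed

lemma ND\<^sub>T_subset: "S \<in> ND\<^sub>T \<Longrightarrow> infinite X \<Longrightarrow> X \<subseteq> S \<Longrightarrow> X \<in> ND\<^sub>T"
  unfolding ND\<^sub>T_def using nowhere_dense_subset[OF _ branches_of_mono, of S X] by simp

section \<open>Infinite traces on a suitable set in \<open>ND\<^sub>T\<close>\<close>

definition extensions :: "bool list \<Rightarrow> bool list set" where
  "extensions s = {s @ u | u. True}"

lemma extensions_Nil [simp]: "extensions [] = UNIV"
  by (simp add: extensions_def)

lemma extensions_split: "extensions s = insert s (\<Union>b. extensions (s @ [b]))"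
proof -
  have "t \<in> extensions s \<longleftrightarrow> t = s \<or> (\<exists>b. t \<in> extensions (s @ [b]))" for t
    unfolding extensions_def by (auto, metis neq_Nil_conv)
  then show ?thesis by blast
qed

lemma koenig_branch:
  assumes "P []" "\<And>s. P s \<Longrightarrow> \<exists>b. P (s @ [b])"
  obtains f :: "nat \<Rightarrow> 'a" where "\<And>n. P (map f [0..<n])"
proof -
  have "\<exists>g. \<forall>n. (P (g n) \<and> (n = 0 \<longrightarrow> g n = [])) \<and> (\<exists>b. g (Suc n) = g n @ [b])"
    using assms by (intro dependent_nat_choice) auto
  then obtain g where g: "\<And>n. P (g n)" "g 0 = []" "\<And>n. \<exists>b. g (Suc n) = g n @ [b]"
    by blast
  then obtain f where f: "\<And>n. g (Suc n) = g n @ [f n]" by metis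
  have "map f [0..<n] = g n" for n
    by (induction n) (auto simp: g f)
  then show ?thesis using g that by metis
qed

lemma accumulation_branch:
  fixes X :: "nat \<Rightarrow> bool list set"
  assumes "\<And>n. infinite (X n)"
  obtains f where "\<And>k. infinite {n. infinite (X n \<inter> extensions (map f [0..<k]))}"
proof (rule koenig_branch[of "\<lambda>s. infinite {n. infinite (X n \<inter> extensions s)}"])
  show "infinite {n. infinite (X n \<inter> extensions [])}" using assms by simp
next
  fix s assume inf: "infinite {n. infinite (X n \<inter> extensions s)}"
  \<comment> \<open>The node \<open>s\<close> itself adds only one point, so a set infinite above
    \<open>s\<close> is infinite above one of the two successors. The pigeonhole principle then
    fixes one successor for infinitely many \<open>n\<close>.\<close>
  have "{n. infinite (X n \<inter> extensions s)} \<subseteq> (\<Union>b. {n. infinite (X n \<inter> extensions (s @ [b]))})"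
    unfolding extensions_split[of s] by (auto simp: Int_insert_right UNIV_bool Int_Un_distrib)
  then show "\<exists>b. infinite {n. infinite (X n \<inter> extensions (s @ [b]))}"
    using inf by (meson finite_UN finite_class.finite_UNIV finite_subset)
qed (use that in blast)

lemma fan_in_ND\<^sub>T:
  assumes X: "\<And>k. X k \<in> ND\<^sub>T" and inf: "\<And>k. infinite (X k \<inter> extensions (map f [0..<k]))"
  shows "(\<Union>k. X k \<inter> extensions (map f [0..<k])) \<in> ND\<^sub>T" (is "?S \<in> _")
proof -
  have "nowhere_dense ({h. h k \<noteq> f k} \<inter> branches_of ?S)" for k
  proof (rule nowhere_dense_subset)
    show "nowhere_dense (\<Union>j\<in>{..k}. branches_of (X j))"
      using X by (intro nowhere_dense_UN) (auto simp: ND\<^sub>T_def)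
    \<comment> \<open>A node above \<open>map f [0..<j]\<close> with \<open>k < j\<close> takes the
      value \<open>f k\<close> at \<open>k\<close>, so it cannot lie on the branch of
      \<open>h\<close>.\<close>
    have "branch h \<inter> ?S \<subseteq> branch h \<inter> (\<Union>j\<in>{..k}. X j)" if "h k \<noteq> f k" for h
    proof
      fix t assume t: "t \<in> branch h \<inter> ?S"
      then obtain j m u where j: "t \<in> X j" "t = map f [0..<j] @ u" "t = map h [0..<m]"
        unfolding branch_def extensions_def by blast
      have "j \<le> k"
      proof (rule ccontr)
        assume "\<not> j \<le> k"
        then have "t ! k = f k" using j(2) by (simp add: nth_append)
        moreover have "k < m"
          using \<open>\<not> j \<le> k\<close> arg_cong[OF j(2), of length] arg_cong[OF j(3), of length] by simp
        then have "t ! k = h k" using j(3) by simp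
        ultimately show False using that by simp
      qed
      then show "t \<in> branch h \<inter> (\<Union>j\<in>{..k}. X j)" using t j by auto
    qed
    then have "{h. h k \<noteq> f k} \<inter> branches_of ?S \<subseteq> branches_of (\<Union>j\<in>{..k}. X j)"
      unfolding branches_of_def by (blast dest: finite_subset)
    then show "{h. h k \<noteq> f k} \<inter> branches_of ?S \<subseteq> (\<Union>j\<in>{..k}. branches_of (X j))"
      by (simp add: branches_of_UN)
  qed
  then have "nowhere_dense (branches_of ?S)" by (rule nowhere_dense_cantor_if_locally)
  moreover have "infinite ?S" using inf[of 0] by (meson UNIV_I UN_upper infinite_super)
  ultimately show ?thesis by (simp add: ND\<^sub>T_def)
qed

lemma ND\<^sub>T_infinitely_many_traces:
  assumes "infinite F" "F \<subseteq> ND\<^sub>T"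
  obtains S where "S \<in> ND\<^sub>T" "infinite {X \<in> F. infinite (X \<inter> S)}"
proof -
  obtain X :: "nat \<Rightarrow> bool list set" where X: "inj X" "range X \<subseteq> F"
    using infinite_countable_subset[OF assms(1)] by blast
  then have XND: "X n \<in> ND\<^sub>T" for n using assms(2) by blast
  then have "infinite (X n)" for n by (simp add: ND\<^sub>T_def)
  then obtain f where "\<And>k. infinite {n. infinite (X n \<inter> extensions (map f [0..<k]))}"
    using accumulation_branch[of X] by blast
  \<comment> \<open>One index may serve several \<open>k\<close>; the bound
    \<open>k \<le> n k\<close> still makes the range of \<open>n\<close> infinite.\<close>
  then have "\<forall>k. \<exists>n\<ge>k. infinite (X n \<inter> extensions (map f [0..<k]))"
    by (auto simp: infinite_nat_iff_unbounded_le)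
  then obtain n where n: "\<And>k. k \<le> n k" "\<And>k. infinite (X (n k) \<inter> extensions (map f [0..<k]))"
    by metis
  define S where "S = (\<Union>k. X (n k) \<inter> extensions (map f [0..<k]))"
  have "S \<in> ND\<^sub>T" unfolding S_def using XND n(2) by (intro fan_in_ND\<^sub>T) auto
  moreover have "infinite {Y \<in> F. infinite (Y \<inter> S)}"
  proof -
    have "infinite (range n)"
      unfolding infinite_nat_iff_unbounded_le using n(1) by blast
    then have "infinite (X ` range n)"
      using X(1) by (meson finite_imageD inj_on_subset subset_UNIV)
    moreover have "infinite (X (n k) \<inter> S)" for k
      by (rule infinite_super[OF _ n(2)[of k]]) (auto simp: S_def)
    then have "X ` range n \<subseteq> {Y \<in> F. infinite (Y \<inter> S)}" using X(2) by auto
    ultimately show ?thesis using infinite_super by blast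
  qed
  ultimately show ?thesis by (rule that)
qed

text \<open>The bijection \<open>e\<close> moves the traces to the natural numbers, over which
  \<open>ad_number\<close> is defined.\<close>

lemma mad_traces:
  fixes e :: "'a \<Rightarrow> nat"
  assumes mad: "mad_in \<X> F" and e: "bij_betw e S UNIV"
    and sub: "\<And>X. infinite X \<Longrightarrow> X \<subseteq> S \<Longrightarrow> X \<in> \<X>"
    and inf: "infinite {X \<in> F. infinite (X \<inter> S)}"
  shows "\<exists>G :: nat set set. infinite G \<and> mad_in {A. infinite A} G \<and> |G| \<le>o |F|"
proof -
  define F' where "F' = {X \<in> F. infinite (X \<inter> S)}"
  define tr where "tr X = e ` (X \<inter> S)" for X
  have inj: "inj_on e S" and surj: "e ` S = UNIV" using e by (auto simp: bij_betw_def)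
  have inf_tr: "infinite (tr X)" if "X \<in> F'" for X
    using that finite_imageD[OF _ inj_on_subset[OF inj Int_lower2]]
    unfolding tr_def F'_def by blast
  have ad_tr: "finite (tr X \<inter> tr Y)" if "X \<in> F'" "Y \<in> F'" "X \<noteq> Y" for X Y
  proof -
    have "tr X \<inter> tr Y \<subseteq> e ` (X \<inter> Y)"
      unfolding tr_def by (auto dest: inj_onD[OF inj])
    moreover have "finite (X \<inter> Y)"
      using mad that unfolding mad_in_def ad_family_def almost_disjoint_def F'_def by blast
    ultimately show ?thesis using finite_subset by blast
  qed
  \<comment> \<open>Two distinct members with the same trace would have a finite trace.\<close>
  have "inj_on tr F'" using ad_tr inf_tr by (metis inj_onI Int_absorb)
  then have "infinite (tr ` F')" using inf finite_imageD unfolding F'_def by blast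
  moreover have "|tr ` F'| \<le>o |F|"
    by (rule ordLeq_transitive[OF card_of_image card_of_mono1]) (auto simp: F'_def)
  moreover have "mad_in {A. infinite A} (tr ` F')"
  proof -
    \<comment> \<open>Maximality is pulled back along \<open>e\<close>: the preimage
      \<open>B\<close> of \<open>A\<close> meets some \<open>X\<close> in \<open>F\<close> in an
      infinite set. As \<open>B\<close> lies in \<open>S\<close>, this \<open>X\<close> has an
      infinite trace.\<close>
    have "\<exists>X\<in>F'. infinite (A \<inter> tr X)" if "infinite A" for A
    proof -
      define B where "B = {s \<in> S. e s \<in> A}"
      have "A \<subseteq> e ` B"
      proof
        fix a assume "a \<in> A"
        moreover obtain s where "s \<in> S" "a = e s" using surj by (metis UNIV_I imageE)
        ultimately show "a \<in> e ` B" by (simp add: B_def)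
      qed
      then have "infinite B" using that finite_surj by blast
      then have "B \<in> \<X>" by (intro sub) (auto simp: B_def)
      then obtain X where X: "X \<in> F" "infinite (B \<inter> X)"
        using mad unfolding mad_in_def almost_disjoint_def by blast
      have "infinite (X \<inter> S)"
        by (rule infinite_super[OF _ X(2)]) (auto simp: B_def)
      moreover have "infinite (e ` (B \<inter> X))"
        using X(2) finite_imageD[OF _ inj_on_subset[OF inj], of "B \<inter> X"]
        unfolding B_def by blast
      then have "infinite (A \<inter> tr X)"
        by (rule infinite_super[rotated]) (auto simp: B_def tr_def)
      ultimately show ?thesis using X(1) by (auto simp: F'_def)
    qed
    then show ?thesis
      using inf_tr ad_tr unfolding mad_in_def ad_family_def almost_disjoint_def
      by (simp add: image_subset_iff) metis
  qed
  ultimately show ?thesis by blast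
qed

section \<open>The two cardinal bounds for an arbitrary mad family\<close>

lemma cov_meager_le_mad_ND\<^sub>T:
  assumes "mad_in ND\<^sub>T F"
  shows "cov_meager \<le>o |F|"
proof -
  have "meager (branches_of X)" if "X \<in> F" for X
    unfolding meager_def using assms that
    by (intro exI[of _ "\<lambda>_. branches_of X"]) (auto simp: mad_in_def ND\<^sub>T_def)
  moreover have "\<exists>X\<in>F. f \<in> branches_of X" for f
    using assms branch_in_ND\<^sub>T[of f]
    unfolding mad_in_def almost_disjoint_def branches_of_def by blast
  then have "\<Union>(branches_of ` F) = UNIV" by blast
  ultimately have "cov_meager \<le>o |branches_of ` F|"
    unfolding cov_meager_def by (intro min_card_least) auto
  then show ?thesis using card_of_image ordLeq_transitive by blast
qed

lemma ad_number_le_mad_ND\<^sub>T: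
  assumes "infinite F" "mad_in ND\<^sub>T F"
  shows "ad_number \<le>o |F|"
proof -
  obtain S where S: "S \<in> ND\<^sub>T" "infinite {X \<in> F. infinite (X \<inter> S)}"
    using ND\<^sub>T_infinitely_many_traces[of F] assms unfolding mad_in_def by blast
  have "infinite S" using S(1) by (simp add: ND\<^sub>T_def)
  then obtain e :: "bool list \<Rightarrow> nat" where "bij_betw e S UNIV"
    using countableE_infinite[of S] by (metis countableI_type)
  then obtain G :: "nat set set"
    where G: "infinite G" "mad_in {A. infinite A} G" "|G| \<le>o |F|"
    using mad_traces[OF assms(2) _ ND\<^sub>T_subset[OF S(1)] S(2)] by blast
  then have "ad_number \<le>o |G|"
    unfolding ad_number_def ad_number_of_def by (intro min_card_least) simp
  then show ?thesis using G(3) ordLeq_transitive by blast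
qed

theorem theorem2p8:
  shows "cov_meager \<le>o ad_number_of ND\<^sub>T \<and> ad_number \<le>o ad_number_of ND\<^sub>T"
proof -
  obtain F where "infinite F" "mad_in ND\<^sub>T F" "ad_number_of ND\<^sub>T = |F|"
    using min_card_attained[OF ND\<^sub>T_class_nonempty] unfolding ad_number_of_def by blast
  then show ?thesis using cov_meager_le_mad_ND\<^sub>T ad_number_le_mad_ND\<^sub>T by simp
qed

end
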